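(* Consider a parametrized statistical model (statistical manifold) $(\Theta,I,\mathbf p)$ on the finite weighted graph $(I,E,\omega)$ and a reference measure $q\in\mathcal P_+(I)$ (all notions as specified in the context), and let $\theta^*=\arg\min_{\theta\in\Theta}\operatorname{D}_{\operatorname{KL}}(p(\theta)\|q)$. The following inequalities hold. (i) If $\operatorname{Ric}(\Theta,I,\mathbf p)\ge\kappa>0$, then the logarithmic Sobolev inequality on parameter space $$\operatorname{D}_{\operatorname{KL}}(p(\theta)\|q)-\operatorname{D}_{\operatorname{KL}}(p(\theta^* )\|q)\le\frac1{2\kappa}\,\mathcal I(p(\theta)\|q)$$ holds for any $\theta\in\Theta$. (ii) If $\operatorname{Ric}(\Theta,I,\mathbf p)\ge\kappa>0$, then the Talagrand inequality on parameter space $$\frac\kappa2\,d_W(\theta,\theta^* )^2\le\operatorname{D}_{\operatorname{KL}}(p(\theta)\|q)-\operatorname{D}_{\operatorname{KL}}(p(\theta^* )\|q)$$ holds for any $\theta\in\Theta$. (iii) If $\operatorname{Ric}(\Theta,I,\mathbf p)\ge\kappa\in\mathbb R$ ($\kappa$ not necessarily positive), then the HWI inequality on parameter space $$\operatorname{D}_{\operatorname{KL}}(p(\theta)\|q)-\operatorname{D}_{\operatorname{KL}}(p(\theta^* )\|q)\le\sqrt{\mathcal I(p(\theta)\|q)}\;d_W(\theta,\theta^* )-\frac\kappa2\,d_W(\theta,\theta^* )^2$$ holds for any $\theta\in\Theta$.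
   Context: **Graph.** $I=\{1,\dots,n\}$ is the discrete sample space, and $(I,E,\omega)$ is a connected undirected graph with weights $\omega_{ij}=\omega_{ji}>0$ if $(i,j)\in E$ and $\omega_{ij}=0$ otherwise. $N(i)$ is the set of neighbors of $i$, and $d_i=\frac{\sum_{j\in N(i)}\omega_{ij}}{\sum_{k=1}^n\sum_{j\in N(k)}\omega_{kj}}$. $\mathcal P_+(I)=\{p\in\mathbb R^n: \sum_i p_i=1,\ p_i>0\}$. For $p\in\mathcal P_+(I)$, $L(p)\in\mathbb R^{n\times n}$ is the weighted graph Laplacian, i.e. the symmetric matrix with quadratic form (sum over undirected edges) $$\Phi^{\mathsf T}L(p)\Phi=\sum_{(i,j)\in E}\omega_{ij}(\Phi_i-\Phi_j)^2\,\tfrac12\Big(\frac{p_i}{d_i}+\frac{p_j}{d_j}\Big),$$ and $L(p)^\dagger$ is its pseudo-inverse. **Model.** The parameter space $\Theta$ is an open subset of $\mathbb R^d$, $d\le n-1$, and $\mathbf p:\Theta\to\mathcal P_+(I)$, $\theta\mapsto p(\theta)=(p_i(\theta))_{i=1}^n$, is the parametrization. Its Jacobi matrix $J_\theta p(\theta)=(\partial p_i/\partial\theta_j)\in\mathbb R^{n\times d}$ is assumed to have rank $d$. **Wasserstein metric on $\Theta$.** $G_W(\theta)=J_\theta p(\theta)^{\mathsf T}L(p(\theta))^\dagger J_\theta p(\theta)$ (positive definite), $g^W_\theta(a,b)=a^{\mathsf T}G_W(\theta)b$ for $a,b\in\mathbb R^d$, $\operatorname{grad}_W f=G_W^{-1}\nabla_\theta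 f$ with $\nabla_\theta$ the Euclidean gradient, and $$d_W(\theta_0,\theta_1)^2=\inf\Big\{\int_0^1\dot\theta(t)^{\mathsf T}G_W(\theta(t))\dot\theta(t)\,dt:\ \theta\in C^1([0,1],\Theta),\ \theta(0)=\theta_0,\ \theta(1)=\theta_1\Big\}.$$ **KL divergence and relative Fisher information functional.** $\operatorname{D}_{\operatorname{KL}}(p\|q)=\sum_{i=1}^n p_i\log\frac{p_i}{q_i}$, and $$\mathcal I(p(\theta)\|q)=g^W_\theta\big(\operatorname{grad}_W\operatorname{D}_{\operatorname{KL}}(p(\theta)\|q),\operatorname{grad}_W\operatorname{D}_{\operatorname{KL}}(p(\theta)\|q)\big).$$ **Ricci curvature lower bound.** $\operatorname{Ric}(\Theta,I,\mathbf p)\ge\kappa$ (with respect to $q$) means: for any constant speed geodesic $\theta_t$, $t\in[0,1]$, connecting $\theta_0,\theta_1$ in $(\Theta,g^W)$, it holds that $$\operatorname{D}_{\operatorname{KL}}(p(\theta_t)\|q)\le(1-t)\operatorname{D}_{\operatorname{KL}}(p(\theta_0)\|q)+t\operatorname{D}_{\operatorname{KL}}(p(\theta_1)\|q)-\frac\kappa2t(1-t)\,d_W(\theta_0,\theta_1)^2.$$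
   Formalization: Added assumption: every θ in Θ is joined to θ* by a minimizing C¹ constant speed geodesic in (Θ, g^W); without it the claim fails, e.g. for disconnected Θ. The parametrization is taken to be C¹, and d ≥ 1. *)

theory Defs
  imports "HOL-Analysis.Analysis"
begin

section \<open>Weighted graphs and the probability simplex\<close>

text \<open>The sample space \<open>{1, \<dots>, n}\<close> is a finite type \<open>'n\<close>. An undirected edge is represented by
  both of its orientations in the symmetric relation \<open>E\<close>. Loops are not excluded; they do not
  contribute to the Laplacian.\<close>

definition weighted_graph :: "('n::finite \<times> 'n) set \<Rightarrow> ('n \<Rightarrow> 'n \<Rightarrow> real) \<Rightarrow> bool" where
  "weighted_graph E \<omega> \<longleftrightarrow>
     sym E \<and>
     (\<forall>i j. (i, j) \<in> E\<^sup>*) \<and>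
     (\<forall>i j. \<omega> i j = \<omega> j i) \<and>
     (\<forall>i j. (i, j) \<in> E \<longrightarrow> \<omega> i j > 0) \<and>
     (\<forall>i j. (i, j) \<notin> E \<longrightarrow> \<omega> i j = 0)"

definition neighbors :: "('n::finite \<times> 'n) set \<Rightarrow> 'n \<Rightarrow> 'n set" where
  "neighbors E i = {j. (i, j) \<in> E}"

definition normalized_degree :: "('n::finite \<times> 'n) set \<Rightarrow> ('n \<Rightarrow> 'n \<Rightarrow> real) \<Rightarrow> 'n \<Rightarrow> real" where
  "normalized_degree E \<omega> i =
     (\<Sum>j\<in>neighbors E i. \<omega> i j) / (\<Sum>k\<in>UNIV. \<Sum>j\<in>neighbors E k. \<omega> k j)"

definition pos_simplex :: "(real^'n::finite) set" where
  "pos_simplex = {p. (\<Sum>i\<in>UNIV. p $ i) = 1 \<and> (\<forall>i. p $ i > 0)}"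

section \<open>The weighted Laplacian and its pseudo-inverse\<close>

definition edge_mobility ::
    "('n::finite \<times> 'n) set \<Rightarrow> ('n \<Rightarrow> 'n \<Rightarrow> real) \<Rightarrow> real^'n \<Rightarrow> 'n \<Rightarrow> 'n \<Rightarrow> real" where
  "edge_mobility E \<omega> p i j =
     \<omega> i j * (1/2 * (p $ i / normalized_degree E \<omega> i + p $ j / normalized_degree E \<omega> j))"

definition laplacian :: "('n::finite \<times> 'n) set \<Rightarrow> ('n \<Rightarrow> 'n \<Rightarrow> real) \<Rightarrow> real^'n \<Rightarrow> real^'n^'n" where
  "laplacian E \<omega> p =
     (\<chi> i j. (if i = j then \<Sum>k\<in>UNIV. edge_mobility E \<omega> p i k else 0) - edge_mobility E \<omega> p i j)"

text \<open>The next two lemmas confirm that \<open>laplacian\<close> is the symmetric matrix with the intended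
  quadratic form. The factor \<open>1/2\<close> in front of the sum over \<open>E\<close> accounts for the two orientations
  of each undirected edge.\<close>

lemma transpose_laplacian:
  assumes "weighted_graph E \<omega>"
  shows "transpose (laplacian E \<omega> p) = laplacian E \<omega> p"
  using assms
  by (auto simp: laplacian_def transpose_def vec_eq_iff edge_mobility_def weighted_graph_def
      add.commute)

lemma laplacian_quadratic_form:
  assumes "weighted_graph E \<omega>"
  shows "\<Phi> \<bullet> (laplacian E \<omega> p *v \<Phi>) =
    1/2 * (\<Sum>(i, j)\<in>E. \<omega> i j * (\<Phi> $ i - \<Phi> $ j)\<^sup>2 *
      (1/2 * (p $ i / normalized_degree E \<omega> i + p $ j / normalized_degree E \<omega> j)))"
proof -
  let ?w = "edge_mobility E \<omega> p"
  have w_sym: "?w i j = ?w j i" for i j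
    using assms by (simp add: edge_mobility_def weighted_graph_def add.commute)
  have w_0: "?w i j = 0" if "(i, j) \<notin> E" for i j
    using assms that by (simp add: edge_mobility_def weighted_graph_def)
  have "(\<Sum>(i, j)\<in>E. \<omega> i j * (\<Phi> $ i - \<Phi> $ j)\<^sup>2 *
      (1/2 * (p $ i / normalized_degree E \<omega> i + p $ j / normalized_degree E \<omega> j)))
      = (\<Sum>(i, j)\<in>E. ?w i j * (\<Phi> $ i - \<Phi> $ j)\<^sup>2)"
    by (intro sum.cong refl) (auto simp: edge_mobility_def mult_ac)
  also have "\<dots> = (\<Sum>(i, j)\<in>UNIV \<times> UNIV. ?w i j * (\<Phi> $ i - \<Phi> $ j)\<^sup>2)"
    by (intro sum.mono_neutral_left) (auto simp: w_0)
  also have "\<dots> = (\<Sum>i\<in>UNIV. \<Sum>j\<in>UNIV. ?w i j * (\<Phi> $ i - \<Phi> $ j)\<^sup>2)"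
    by (simp add: sum.cartesian_product)
  also have "\<dots> = (\<Sum>i\<in>UNIV. \<Sum>j\<in>UNIV. ?w i j * (\<Phi> $ i)\<^sup>2)
      + (\<Sum>i\<in>UNIV. \<Sum>j\<in>UNIV. ?w i j * (\<Phi> $ j)\<^sup>2)
      - 2 * (\<Sum>i\<in>UNIV. \<Sum>j\<in>UNIV. ?w i j * (\<Phi> $ i * \<Phi> $ j))"
    by (simp add: power2_eq_square algebra_simps sum.distrib sum_subtractf sum_distrib_left)
  also have "(\<Sum>i\<in>UNIV. \<Sum>j\<in>UNIV. ?w i j * (\<Phi> $ j)\<^sup>2) = (\<Sum>i\<in>UNIV. \<Sum>j\<in>UNIV. ?w i j * (\<Phi> $ i)\<^sup>2)"
    by (subst sum.swap) (simp add: w_sym)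
  finally have sum_E: "(\<Sum>(i, j)\<in>E. \<omega> i j * (\<Phi> $ i - \<Phi> $ j)\<^sup>2 *
      (1/2 * (p $ i / normalized_degree E \<omega> i + p $ j / normalized_degree E \<omega> j)))
      = 2 * ((\<Sum>i\<in>UNIV. \<Sum>j\<in>UNIV. ?w i j * (\<Phi> $ i)\<^sup>2)
           - (\<Sum>i\<in>UNIV. \<Sum>j\<in>UNIV. ?w i j * (\<Phi> $ i * \<Phi> $ j)))"
    by simp
  have row: "(laplacian E \<omega> p *v \<Phi>) $ i = (\<Sum>k\<in>UNIV. ?w i k) * \<Phi> $ i - (\<Sum>j\<in>UNIV. ?w i j * \<Phi> $ j)"
    for i
  proof -
    have "(laplacian E \<omega> p *v \<Phi>) $ i
        = (\<Sum>j\<in>UNIV. (if i = j then (\<Sum>k\<in>UNIV. ?w i k) * \<Phi> $ j else 0) - ?w i j * \<Phi> $ j)"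
      unfolding laplacian_def matrix_vector_mult_def
      by (auto intro!: sum.cong simp: left_diff_distrib)
    then show ?thesis
      by (simp add: sum_subtractf)
  qed
  have "\<Phi> \<bullet> (laplacian E \<omega> p *v \<Phi>) =
      (\<Sum>i\<in>UNIV. \<Sum>j\<in>UNIV. ?w i j * (\<Phi> $ i)\<^sup>2) - (\<Sum>i\<in>UNIV. \<Sum>j\<in>UNIV. ?w i j * (\<Phi> $ i * \<Phi> $ j))"
    by (simp add: inner_vec_def row sum_distrib_left sum_distrib_right power2_eq_square
        algebra_simps sum_subtractf)
  then show ?thesis
    using sum_E by simp
qed

text \<open>The Moore--Penrose inverse, characterized by the four Penrose equations.\<close>

definition pseudo_inverse :: "real^'n::finite^'m::finite \<Rightarrow> real^'m^'n" where
  "pseudo_inverse A = (THE X.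
     A ** X ** A = A \<and> X ** A ** X = X \<and>
     transpose (A ** X) = A ** X \<and> transpose (X ** A) = X ** A)"

section \<open>Parametrized statistical models and the Wasserstein metric\<close>

definition statistical_model ::
    "(real^'d::finite) set \<Rightarrow> (real^'d \<Rightarrow> real^'n::finite) \<Rightarrow> bool" where
  "statistical_model \<Theta> p \<longleftrightarrow>
     open \<Theta> \<and>
     CARD('d) \<le> CARD('n) - 1 \<and>
     p ` \<Theta> \<subseteq> pos_simplex \<and>
     (\<forall>\<theta>\<in>\<Theta>. p differentiable (at \<theta>)) \<and>
     continuous_on \<Theta> (\<lambda>\<theta>. jacobian p (at \<theta>)) \<and>
     (\<forall>\<theta>\<in>\<Theta>. rank (jacobian p (at \<theta>)) = CARD('d))"

definition G_W ::
    "('n::finite \<times> 'n) set \<Rightarrow> ('n \<Rightarrow> 'n \<Rightarrow> real) \<Rightarrow> (real^'d::finite \<Rightarrow> real^'n) \<Rightarrow> real^'d \<Rightarrow> real^'d^'d"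
  where
  "G_W E \<omega> p \<theta> =
     transpose (jacobian p (at \<theta>)) ** pseudo_inverse (laplacian E \<omega> (p \<theta>)) ** jacobian p (at \<theta>)"

definition g_W ::
    "('n::finite \<times> 'n) set \<Rightarrow> ('n \<Rightarrow> 'n \<Rightarrow> real) \<Rightarrow> (real^'d::finite \<Rightarrow> real^'n) \<Rightarrow>
     real^'d \<Rightarrow> real^'d \<Rightarrow> real^'d \<Rightarrow> real"
  where
  "g_W E \<omega> p \<theta> a b = a \<bullet> (G_W E \<omega> p \<theta> *v b)"

definition euclidean_grad :: "(real^'d::finite \<Rightarrow> real) \<Rightarrow> real^'d \<Rightarrow> real^'d" where
  "euclidean_grad f \<theta> = (\<chi> j. frechet_derivative f (at \<theta>) (axis j 1))"

definition grad_W ::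
    "('n::finite \<times> 'n) set \<Rightarrow> ('n \<Rightarrow> 'n \<Rightarrow> real) \<Rightarrow> (real^'d::finite \<Rightarrow> real^'n) \<Rightarrow>
     (real^'d \<Rightarrow> real) \<Rightarrow> real^'d \<Rightarrow> real^'d"
  where
  "grad_W E \<omega> p f \<theta> = matrix_inv (G_W E \<omega> p \<theta>) *v euclidean_grad f \<theta>"

section \<open>Curves, distance and geodesics\<close>

definition velocity :: "(real \<Rightarrow> real^'d::finite) \<Rightarrow> real \<Rightarrow> real^'d" where
  "velocity \<gamma> t = vector_derivative \<gamma> (at t within {0..1})"

text \<open>At the endpoints of \<open>[0, 1]\<close> the derivatives are one-sided.\<close>

definition C1_curve ::
    "(real^'d::finite) set \<Rightarrow> real^'d \<Rightarrow> real^'d \<Rightarrow> (real \<Rightarrow> real^'d) \<Rightarrow> bool" where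
  "C1_curve \<Theta> \<theta>0 \<theta>1 \<gamma> \<longleftrightarrow>
     \<gamma> ` {0..1} \<subseteq> \<Theta> \<and> \<gamma> 0 = \<theta>0 \<and> \<gamma> 1 = \<theta>1 \<and>
     (\<forall>t\<in>{0..1}. \<gamma> differentiable (at t within {0..1})) \<and>
     continuous_on {0..1} (velocity \<gamma>)"

definition energy ::
    "('n::finite \<times> 'n) set \<Rightarrow> ('n \<Rightarrow> 'n \<Rightarrow> real) \<Rightarrow> (real^'d::finite \<Rightarrow> real^'n) \<Rightarrow>
     (real \<Rightarrow> real^'d) \<Rightarrow> real"
  where
  "energy E \<omega> p \<gamma> = integral {0..1} (\<lambda>t. g_W E \<omega> p (\<gamma> t) (velocity \<gamma> t) (velocity \<gamma> t))"

text \<open>The infimum is meaningful only for points joined by some \<open>C\<^sup>1\<close> curve in \<open>\<Theta>\<close>; otherwise \<open>d_W\<close>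
  is an unspecified real number instead of \<open>\<infinity>\<close>. Below, \<open>d_W\<close> is only used for points joined by a
  geodesic.\<close>

definition d_W ::
    "('n::finite \<times> 'n) set \<Rightarrow> ('n \<Rightarrow> 'n \<Rightarrow> real) \<Rightarrow> (real^'d::finite) set \<Rightarrow>
     (real^'d \<Rightarrow> real^'n) \<Rightarrow> real^'d \<Rightarrow> real^'d \<Rightarrow> real"
  where
  "d_W E \<omega> \<Theta> p \<theta>0 \<theta>1 = sqrt (Inf (energy E \<omega> p ` {\<gamma>. C1_curve \<Theta> \<theta>0 \<theta>1 \<gamma>}))"

text \<open>Geodesics are minimizing, as is usual for constant speed geodesics of a transport distance:
  a \<open>C\<^sup>1\<close> curve of constant Riemannian speed whose energy attains the infimum defining the squared
  distance.\<close>

definition constant_speed_geodesic ::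
    "('n::finite \<times> 'n) set \<Rightarrow> ('n \<Rightarrow> 'n \<Rightarrow> real) \<Rightarrow> (real^'d::finite) set \<Rightarrow>
     (real^'d \<Rightarrow> real^'n) \<Rightarrow> real^'d \<Rightarrow> real^'d \<Rightarrow> (real \<Rightarrow> real^'d) \<Rightarrow> bool"
  where
  "constant_speed_geodesic E \<omega> \<Theta> p \<theta>0 \<theta>1 \<gamma> \<longleftrightarrow>
     C1_curve \<Theta> \<theta>0 \<theta>1 \<gamma> \<and>
     (\<exists>c. \<forall>t\<in>{0..1}. sqrt (g_W E \<omega> p (\<gamma> t) (velocity \<gamma> t) (velocity \<gamma> t)) = c) \<and>
     energy E \<omega> p \<gamma> = (d_W E \<omega> \<Theta> p \<theta>0 \<theta>1)\<^sup>2"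

section \<open>Divergence, Fisher information and curvature\<close>

definition D_KL :: "real^'n::finite \<Rightarrow> real^'n \<Rightarrow> real" where
  "D_KL p q = (\<Sum>i\<in>UNIV. p $ i * ln (p $ i / q $ i))"

definition rel_Fisher_information ::
    "('n::finite \<times> 'n) set \<Rightarrow> ('n \<Rightarrow> 'n \<Rightarrow> real) \<Rightarrow> (real^'d::finite \<Rightarrow> real^'n) \<Rightarrow>
     real^'n \<Rightarrow> real^'d \<Rightarrow> real"
  where
  "rel_Fisher_information E \<omega> p q \<theta> =
     g_W E \<omega> p \<theta>
       (grad_W E \<omega> p (\<lambda>\<theta>'. D_KL (p \<theta>') q) \<theta>) (grad_W E \<omega> p (\<lambda>\<theta>'. D_KL (p \<theta>') q) \<theta>)"

definition Ric_ge ::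
    "('n::finite \<times> 'n) set \<Rightarrow> ('n \<Rightarrow> 'n \<Rightarrow> real) \<Rightarrow> (real^'d::finite) set \<Rightarrow>
     (real^'d \<Rightarrow> real^'n) \<Rightarrow> real^'n \<Rightarrow> real \<Rightarrow> bool"
  where
  "Ric_ge E \<omega> \<Theta> p q \<kappa> \<longleftrightarrow>
     (\<forall>\<theta>0 \<theta>1 \<gamma>. constant_speed_geodesic E \<omega> \<Theta> p \<theta>0 \<theta>1 \<gamma> \<longrightarrow>
        (\<forall>t\<in>{0..1}.
           D_KL (p (\<gamma> t)) q \<le>
             (1 - t) * D_KL (p \<theta>0) q + t * D_KL (p \<theta>1) q
             - \<kappa> / 2 * t * (1 - t) * (d_W E \<omega> \<Theta> p \<theta>0 \<theta>1)\<^sup>2))"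

end

theory Submission
  imports Defs
begin

text \<open>Along a constant speed geodesic \<open>\<gamma>\<close> from \<open>\<theta>\<close> to \<open>\<theta>\<^sup>*\<close>, the curvature bound compares
  the divergence at \<open>\<gamma> t\<close> with its endpoint values. Since \<open>\<theta>\<^sup>*\<close> is a minimizer, dividing by
  \<open>1 - t\<close> and letting \<open>t\<close> tend to \<open>1\<close> gives the Talagrand inequality. Dividing by \<open>t\<close> and letting
  \<open>t\<close> tend to \<open>0\<close> bounds the derivative of the divergence at \<open>\<theta>\<close> in direction \<open>\<gamma>' 0\<close>, and the
  Cauchy--Schwarz inequality for the Wasserstein metric turns this into the HWI inequality. The
  logarithmic Sobolev inequality follows from HWI by completing the square. That the metric is
  positive definite rests on the kernel of the Laplacian of a connected graph being spanned by the
  constant vector.\<close>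

section \<open>Symmetric matrices and pseudo-inverses\<close>

lemma matrix_diff_ldistrib: "A ** (B - C) = A ** B - A ** C"
  for A :: "'a::ring_1^'n^'m" and B C :: "'a^'k^'n"
  by (simp add: matrix_matrix_mult_def vec_eq_iff algebra_simps sum_subtractf)

lemma matrix_diff_rdistrib: "(A - B) ** C = A ** C - B ** C"
  for A B :: "'a::ring_1^'n^'m" and C :: "'a^'k^'n"
  by (simp add: matrix_matrix_mult_def vec_eq_iff algebra_simps sum_subtractf)

lemma matrix_add_rdistrib: "(A + B) ** C = A ** C + B ** C"
  for A B :: "'a::semiring_1^'n^'m" and C :: "'a^'k^'n"
  by (simp add: matrix_matrix_mult_def vec_eq_iff algebra_simps sum.distrib)

lemma transpose_diff: "transpose (A - B) = transpose A - transpose B"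
  by (simp add: transpose_def vec_eq_iff)

lemma inner_matrix_transpose: "x \<bullet> (A *v y) = (transpose A *v x) \<bullet> y"
  for A :: "real^'n^'m"
  by (simp add: dot_lmul_matrix)

text \<open>For two solutions \<open>X\<close> and \<open>Y\<close> of the Penrose equations,
  \<open>A ** X\<close> and \<open>A ** Y\<close> are symmetric, so transposing
  \<open>A ** X = (A ** Y) ** (A ** X)\<close> swaps the factors and gives
  \<open>A ** X = A ** Y\<close>. Likewise \<open>X ** A = Y ** A\<close>, whence
  \<open>Y = Y ** A ** Y = X ** A ** X = X\<close>.\<close>

lemma pseudo_inverse_eqI:
  fixes A :: "real^'n^'m" and X :: "real^'m^'n"
  assumes "A ** X ** A = A" "X ** A ** X = X"
    and "transpose (A ** X) = A ** X" "transpose (X ** A) = X ** A"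
  shows "pseudo_inverse A = X"
  unfolding pseudo_inverse_def
proof (rule the_equality)
  fix Y :: "real^'m^'n"
  assume Y: "A ** Y ** A = A \<and> Y ** A ** Y = Y \<and>
    transpose (A ** Y) = A ** Y \<and> transpose (Y ** A) = Y ** A"
  have "A ** X = (A ** Y) ** (A ** X)"
    using Y by (simp add: matrix_mul_assoc)
  then have "transpose (A ** X) = transpose ((A ** Y) ** (A ** X))"
    by simp
  then have "A ** X = (A ** X) ** (A ** Y)"
    using Y assms(3) by (simp only: matrix_transpose_mul[of "A ** Y"])
  then have left: "A ** X = A ** Y"
    using assms(1) by (simp add: matrix_mul_assoc)
  have "X ** A = (X ** A) ** (Y ** A)"
    using Y by (metis matrix_mul_assoc)
  then have "transpose (X ** A) = transpose ((X ** A) ** (Y ** A))"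
    by simp
  then have "X ** A = (Y ** A) ** (X ** A)"
    using Y assms(4) by (simp only: matrix_transpose_mul[of "X ** A"])
  then have right: "X ** A = Y ** A"
    using assms(1) by (metis matrix_mul_assoc)
  show "Y = X"
    using Y assms(2) left right by (metis matrix_mul_assoc)
qed (use assms in simp)

text \<open>Adding the projection \<open>P\<close> onto the kernel makes \<open>A\<close> invertible; subtracting \<open>P\<close> again from
  the inverse gives the pseudo-inverse.\<close>

lemma
  fixes A P :: "real^'n^'n"
  assumes A: "transpose A = A" and P: "transpose P = P" "P ** P = P"
    and AP: "A ** P = 0" and ker: "\<And>x. A *v x = 0 \<Longrightarrow> P *v x = x"
  shows transpose_pseudo_inverse: "transpose (pseudo_inverse A) = pseudo_inverse A"
    and mult_pseudo_inverse: "A ** pseudo_inverse A = mat 1 - P"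
    and pseudo_inverse_mult_pseudo_inverse:
      "pseudo_inverse A ** A ** pseudo_inverse A = pseudo_inverse A"
proof -
  define M where "M = A + P"
  define N where "N = matrix_inv M"
  define X where "X = N - P"
  have "transpose (A ** P) = 0"
    unfolding AP by (simp add: transpose_def vec_eq_iff)
  then have PA: "P ** A = 0"
    by (simp add: matrix_transpose_mul A P)
  have MT: "transpose M = M"
    using A P by (simp add: M_def transpose_def vec_eq_iff)
  have MP: "M ** P = P" and PM: "P ** M = P"
    by (simp_all add: M_def matrix_add_ldistrib matrix_add_rdistrib AP PA P)
  \<comment> \<open>Applying \<open>P\<close> gives \<open>P *v x = 0\<close>, since
    \<open>P ** M = P\<close>. Then \<open>x\<close> lies in the kernel of \<open>A\<close>, where
    \<open>P\<close> acts as the identity, so \<open>x\<close> vanishes.\<close>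
  have "x = 0" if "M *v x = 0" for x
  proof -
    have "P *v x = 0"
      using that PM by (metis matrix_vector_mul_assoc matrix_vector_mult_0_right)
    moreover have "A *v x = 0"
      using that calculation by (simp add: M_def matrix_vector_mult_add_rdistrib)
    ultimately show ?thesis
      using ker by metis
  qed
  then have "invertible M"
    by (simp add: invertible_left_inverse matrix_left_invertible_ker)
  then have "M ** matrix_inv M = mat 1 \<and> matrix_inv M ** M = mat 1"
    unfolding invertible_def matrix_inv_def by (rule someI_ex)
  then have MN: "M ** N = mat 1" and NM: "N ** M = mat 1"
    by (simp_all add: N_def)
  \<comment> \<open>The transpose of a right inverse of the symmetric \<open>M\<close> is a left
    inverse, and the inverse is unique.\<close>
  have NT: "transpose N = N"
  proof -
    have "transpose N ** M = mat 1"
      using arg_cong[OF MN, of transpose] by (simp add: matrix_transpose_mul MT)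
    then show ?thesis
      using MN by (metis matrix_mul_assoc matrix_mul_lid matrix_mul_rid)
  qed
  have NP: "N ** P = P"
    using MP NM by (metis matrix_mul_assoc matrix_mul_lid)
  have PN: "P ** N = P"
    using PM MN by (metis matrix_mul_assoc matrix_mul_rid)
  have A_eq: "A = M - P"
    by (simp add: M_def)
  have AX: "A ** X = mat 1 - P" and XA: "X ** A = mat 1 - P"
    by (simp_all add: A_eq X_def matrix_diff_ldistrib matrix_diff_rdistrib MN NM MP PM NP PN P)
  have "P ** X = 0"
    by (simp add: X_def matrix_diff_ldistrib PN P)
  then have XAX: "X ** A ** X = X"
    by (simp add: XA matrix_diff_rdistrib)
  have "pseudo_inverse A = X"
  proof (rule pseudo_inverse_eqI)
    show "A ** X ** A = A"
      by (simp add: AX matrix_diff_rdistrib PA)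
  qed (rule XAX, simp_all add: AX XA transpose_diff P)
  then show "transpose (pseudo_inverse A) = pseudo_inverse A"
    "A ** pseudo_inverse A = mat 1 - P"
    "pseudo_inverse A ** A ** pseudo_inverse A = pseudo_inverse A"
    by (simp_all add: AX XAX) (simp add: X_def transpose_diff NT P)
qed

text \<open>The form is nonnegative on the part of \<open>x\<close> orthogonal to \<open>y\<close>
  with respect to \<open>A\<close>; expanding this gives the bound.\<close>

lemma pos_def_cauchy_schwarz:
  fixes A :: "real^'n^'n"
  assumes A: "transpose A = A" and pos: "\<And>x. x \<noteq> 0 \<Longrightarrow> x \<bullet> (A *v x) > 0"
  shows "\<bar>x \<bullet> (A *v y)\<bar> \<le> sqrt (x \<bullet> (A *v x)) * sqrt (y \<bullet> (A *v y))"
proof (cases "y = 0")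
  case False
  define a where "a = x \<bullet> (A *v y)"
  define c where "c = y \<bullet> (A *v y)"
  have c: "c > 0"
    using pos[OF False] by (simp add: c_def)
  have yx: "y \<bullet> (A *v x) = a"
    using inner_matrix_transpose[of y A x] by (simp add: A a_def inner_commute)
  \<comment> \<open>The coefficient \<open>a / c\<close> makes \<open>z\<close> orthogonal to
    \<open>y\<close> with respect to \<open>A\<close>.\<close>
  define z where "z = x - (a / c) *\<^sub>R y"
  have "0 \<le> z \<bullet> (A *v z)"
    using pos[of z] by (cases "z = 0") auto
  also have "\<dots> = x \<bullet> (A *v x) - (a / c) * a - (a / c) * a + (a / c) * ((a / c) * c)"
    by (simp add: z_def matrix_vector_mult_diff_distrib matrix_vector_mult_scaleR
        inner_diff_left inner_diff_right yx flip: a_def c_def)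
  also have "\<dots> = x \<bullet> (A *v x) - a\<^sup>2 / c"
    using c by (simp add: power2_eq_square)
  finally have "a\<^sup>2 \<le> x \<bullet> (A *v x) * c"
    using c by (simp add: field_simps)
  then have "\<bar>a\<bar> \<le> sqrt (x \<bullet> (A *v x) * c)"
    by (metis real_sqrt_abs real_sqrt_le_mono)
  then show ?thesis
    by (simp add: real_sqrt_mult a_def c_def)
qed simp

section \<open>The Laplacian of a connected graph\<close>

text \<open>The orthogonal projection onto the constant vectors. For a connected graph and a point
  of the simplex its range is the kernel of the Laplacian, so it serves as \<open>P\<close> in the
  construction of the pseudo-inverse.\<close>

definition mean_projection :: "real^'n^'n" where
  "mean_projection = (\<chi> i j. 1 / real CARD('n))"

lemma mean_projection_mult_nth: "(mean_projection *v x) $ i = (\<Sum>j\<in>UNIV. x $ j) / real CARD('n)"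
  for x :: "real^'n"
  by (simp add: mean_projection_def matrix_vector_mult_def sum_divide_distrib)

lemma transpose_mean_projection: "transpose mean_projection = mean_projection"
  by (simp add: mean_projection_def transpose_def)

lemma mean_projection_idem: "mean_projection ** mean_projection = mean_projection"
  by (simp add: mean_projection_def matrix_matrix_mult_def vec_eq_iff)

text \<open>Each diagonal entry collects the mobilities of its row, so all row sums vanish.\<close>

lemma laplacian_mult_mean_projection: "laplacian E \<omega> p ** mean_projection = 0"
proof -
  have "(\<Sum>j\<in>UNIV. laplacian E \<omega> p $ i $ j) = 0" for i
    by (simp add: laplacian_def sum_subtractf)
  then show ?thesis
    by (simp add: vec_eq_iff matrix_matrix_mult_def mean_projection_def flip: sum_divide_distrib)
qed

text \<open>The bound on \<open>CARD('n)\<close> rules out a single vertex without edges, whose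
  degree would be the default value \<open>0 / 0 = 0\<close>.\<close>

lemma normalized_degree_pos:
  fixes E :: "('n::finite \<times> 'n) set"
  assumes graph: "weighted_graph E \<omega>" and card: "CARD('n) \<ge> 2"
  shows "normalized_degree E \<omega> i > 0"
proof -
  have pos: "(\<Sum>j\<in>neighbors E k. \<omega> k j) > 0" for k
  proof (rule sum_pos)
    have "card (UNIV :: 'n set) \<noteq> card {k}"
      using card by simp
    then obtain l where "l \<noteq> k"
      by (metis UNIV_eq_I singleton_iff)
    \<comment> \<open>A path from \<open>k\<close> to a different vertex has a first edge, which
      supplies a neighbor of \<open>k\<close>.\<close>
    moreover have "(k, l) \<in> E\<^sup>*"
      using graph by (auto simp: weighted_graph_def)
    ultimately show "neighbors E k \<noteq> {}"
      by (auto simp: neighbors_def elim: converse_rtranclE)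
    show "\<omega> k j > 0" if "j \<in> neighbors E k" for j
      using graph that unfolding neighbors_def weighted_graph_def by blast
  qed simp
  then have "(\<Sum>k\<in>UNIV. \<Sum>j\<in>neighbors E k. \<omega> k j) > 0"
    by (rule sum_pos[rotated 2]) auto
  with pos show ?thesis
    by (simp add: normalized_degree_def)
qed

text \<open>The quadratic form is a sum of nonnegative edge terms. If it vanishes, \<open>x\<close>
  agrees across every edge, hence along every path, and connectedness makes it constant.\<close>

lemma
  fixes E :: "('n::finite \<times> 'n) set"
  assumes graph: "weighted_graph E \<omega>" and card: "CARD('n) \<ge> 2" and p: "p \<in> pos_simplex"
  shows laplacian_nonneg: "x \<bullet> (laplacian E \<omega> p *v x) \<ge> 0"
    and laplacian_kernel: "x \<bullet> (laplacian E \<omega> p *v x) = 0 \<Longrightarrow> mean_projection *v x = x"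
proof -
  let ?c = "\<lambda>i j. \<omega> i j * (x $ i - x $ j)\<^sup>2 *
      (1/2 * (p $ i / normalized_degree E \<omega> i + p $ j / normalized_degree E \<omega> j))"
  have w: "\<omega> i j > 0" if "(i, j) \<in> E" for i j
    using graph that by (auto simp: weighted_graph_def)
  have m: "1/2 * (p $ i / normalized_degree E \<omega> i + p $ j / normalized_degree E \<omega> j) > 0" for i j
    using p normalized_degree_pos[OF graph card] by (auto simp: pos_simplex_def intro!: add_pos_pos)
  have c: "?c i j \<ge> 0" if "(i, j) \<in> E" for i j
    using w[OF that] m[of i j] by (intro mult_nonneg_nonneg) auto
  have q: "x \<bullet> (laplacian E \<omega> p *v x) = 1/2 * (\<Sum>(i, j)\<in>E. ?c i j)"
    by (rule laplacian_quadratic_form[OF graph])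
  show "x \<bullet> (laplacian E \<omega> p *v x) \<ge> 0"
    unfolding q using c by (auto intro!: sum_nonneg)
  assume "x \<bullet> (laplacian E \<omega> p *v x) = 0"
  with q have "(\<Sum>(i, j)\<in>E. ?c i j) = 0"
    by simp
  then have zero: "?c i j = 0" if "(i, j) \<in> E" for i j
    using c that by (subst (asm) sum_nonneg_eq_0_iff) auto
  have edge: "x $ i = x $ j" if "(i, j) \<in> E" for i j
    using zero[OF that] w[OF that] m[of i j] by (metis less_irrefl mult_eq_0_iff eq_iff_diff_eq_0 power2_eq_square)
  have "x $ i = x $ j" if "(i, j) \<in> E\<^sup>*" for i j
    using that by induction (auto dest: edge)
  then have const: "x $ i = x $ j" for i j
    using graph by (auto simp: weighted_graph_def)
  show "mean_projection *v x = x"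
    unfolding vec_eq_iff
  proof
    fix i
    have "(\<Sum>j\<in>UNIV. x $ j) = (\<Sum>j\<in>(UNIV::'n set). x $ i)"
      by (intro sum.cong refl const)
    then show "(mean_projection *v x) $ i = x $ i"
      by (simp add: mean_projection_mult_nth)
  qed
qed

text \<open>A vector \<open>u\<close> with zero sum satisfies \<open>u = L v\<close> for
  \<open>v = X u\<close>, where \<open>L\<close> is the Laplacian and \<open>X\<close> its
  pseudo-inverse. The form of \<open>X\<close> at \<open>u\<close> is therefore the form of
  \<open>L\<close> at \<open>v\<close>; it can vanish only if \<open>v\<close> is constant, and then
  \<open>u = L v = 0\<close>.\<close>

lemma
  fixes E :: "('n::finite \<times> 'n) set"
  assumes "weighted_graph E \<omega>" "CARD('n) \<ge> 2" "p \<in> pos_simplex"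
  shows transpose_pseudo_inverse_laplacian:
      "transpose (pseudo_inverse (laplacian E \<omega> p)) = pseudo_inverse (laplacian E \<omega> p)"
    and pseudo_inverse_laplacian_pos:
      "(\<Sum>i\<in>UNIV. u $ i) = 0 \<Longrightarrow> u \<noteq> 0 \<Longrightarrow> u \<bullet> (pseudo_inverse (laplacian E \<omega> p) *v u) > 0"
proof -
  let ?L = "laplacian E \<omega> p"
  let ?X = "pseudo_inverse ?L"
  have "mean_projection *v x = x" if "?L *v x = 0" for x
    using that by (intro laplacian_kernel[OF assms]) simp
  note prem = transpose_laplacian[OF assms(1)] transpose_mean_projection mean_projection_idem
    laplacian_mult_mean_projection this
  show XT: "transpose ?X = ?X"
    by (rule transpose_pseudo_inverse[OF prem])
  have LX: "?L ** ?X = mat 1 - mean_projection"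
    by (rule mult_pseudo_inverse[OF prem])
  have XLX: "?X ** ?L ** ?X = ?X"
    by (rule pseudo_inverse_mult_pseudo_inverse[OF prem])
  assume u: "(\<Sum>i\<in>UNIV. u $ i) = 0" "u \<noteq> 0"
  have Pu: "mean_projection *v u = 0"
    using u(1) by (simp add: vec_eq_iff mean_projection_mult_nth)
  have Lv: "?L *v (?X *v u) = u"
    by (simp add: matrix_vector_mul_assoc LX matrix_vector_mult_diff_rdistrib Pu)
  have eq: "u \<bullet> (?X *v u) = (?X *v u) \<bullet> (?L *v (?X *v u))"
    by (simp add: Lv inner_commute)
  have "u \<bullet> (?X *v u) \<noteq> 0"
  proof
    assume "u \<bullet> (?X *v u) = 0"
    then have "mean_projection *v (?X *v u) = ?X *v u"
      using eq laplacian_kernel[OF assms] by simp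
    then have "?L *v (?X *v u) = 0"
      by (metis laplacian_mult_mean_projection matrix_vector_mul_assoc matrix_vector_mult_0)
    with Lv u(2) show False
      by simp
  qed
  then show "u \<bullet> (?X *v u) > 0"
    using eq laplacian_nonneg[OF assms] by (metis less_eq_real_def)
qed

section \<open>The Wasserstein metric tensor\<close>

text \<open>The metric is the pullback along the Jacobian of the form given by the pseudo-inverse;
  positivity is inherited from there.\<close>

lemma g_W_pullback:
  "g_W E \<omega> p \<theta> a b = (jacobian p (at \<theta>) *v a) \<bullet>
     (pseudo_inverse (laplacian E \<omega> (p \<theta>)) *v (jacobian p (at \<theta>) *v b))"
  unfolding g_W_def G_W_def
  by (simp only: inner_matrix_transpose[of a] matrix_vector_mul_assoc[symmetric] transpose_transpose)

text \<open>Index types are nonempty, so \<open>1 \<le> CARD('d) \<le> CARD('n) - 1\<close>, a bound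
  that also excludes \<open>CARD('n) = 1\<close> under truncated subtraction.\<close>

lemma statistical_model_card:
  assumes "statistical_model \<Theta> (p :: real^'d::finite \<Rightarrow> real^'n::finite)"
  shows "CARD('n) \<ge> 2"
proof -
  have "CARD('d) \<ge> 1"
    by (simp add: Suc_leI)
  with assms show ?thesis
    unfolding statistical_model_def by linarith
qed

text \<open>On the open set \<open>\<Theta>\<close> the coordinates of \<open>p\<close> sum to the
  constant \<open>1\<close>, so the derivative of this sum is zero. Tangent vectors thus land where
  the pseudo-inverse is positive definite.\<close>

lemma jacobian_sum_zero:
  fixes p :: "real^'d::finite \<Rightarrow> real^'n::finite"
  assumes model: "statistical_model \<Theta> p" and \<theta>: "\<theta> \<in> \<Theta>"
  shows "(\<Sum>i\<in>UNIV. (jacobian p (at \<theta>) *v a) $ i) = 0"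
proof -
  have "(p has_derivative (\<lambda>h. jacobian p (at \<theta>) *v h)) (at \<theta>)"
    using model \<theta> by (auto simp: statistical_model_def simp flip: jacobian_works)
  then have "((\<lambda>x. \<Sum>i\<in>UNIV. p x $ i) has_derivative
      (\<lambda>h. \<Sum>i\<in>UNIV. (jacobian p (at \<theta>) *v h) $ i)) (at \<theta>)"
    by (intro has_derivative_sum bounded_linear.has_derivative[OF bounded_linear_vec_nth])
  moreover have "((\<lambda>x. \<Sum>i\<in>UNIV. p x $ i) has_derivative (\<lambda>h. 0)) (at \<theta>)"
  proof (rule has_derivative_transform_within_open)
    show "((\<lambda>x. 1 :: real) has_derivative (\<lambda>h. 0)) (at \<theta>)"
      by simp
  qed (use model \<theta> in \<open>auto simp: statistical_model_def pos_simplex_def image_subset_iff\<close>)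
  ultimately show ?thesis
    using has_derivative_unique by metis
qed

text \<open>Full rank makes the Jacobian injective, so a nonzero \<open>a\<close> is sent to a
  nonzero vector with zero sum.\<close>

lemma
  assumes graph: "weighted_graph E \<omega>" and model: "statistical_model \<Theta> p" and \<theta>: "\<theta> \<in> \<Theta>"
  shows transpose_G_W: "transpose (G_W E \<omega> p \<theta>) = G_W E \<omega> p \<theta>"
    and g_W_pos: "a \<noteq> 0 \<Longrightarrow> g_W E \<omega> p \<theta> a a > 0"
proof -
  have "p \<theta> \<in> pos_simplex"
    using model \<theta> by (auto simp: statistical_model_def)
  note prem = graph statistical_model_card[OF model] this
  show "transpose (G_W E \<omega> p \<theta>) = G_W E \<omega> p \<theta>"
    by (simp add: G_W_def matrix_transpose_mul matrix_mul_assoc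
        transpose_pseudo_inverse_laplacian[OF prem])
  assume "a \<noteq> 0"
  have "inj ((*v) (jacobian p (at \<theta>)))"
    using model \<theta> by (simp add: statistical_model_def flip: full_rank_injective)
  with \<open>a \<noteq> 0\<close> have "jacobian p (at \<theta>) *v a \<noteq> 0"
    by (metis injD matrix_vector_mult_0_right)
  then show "g_W E \<omega> p \<theta> a a > 0"
    unfolding g_W_pullback
    by (intro pseudo_inverse_laplacian_pos[OF prem] jacobian_sum_zero[OF model \<theta>])
qed

lemma g_W_nonneg:
  assumes "weighted_graph E \<omega>" "statistical_model \<Theta> p" "\<theta> \<in> \<Theta>"
  shows "g_W E \<omega> p \<theta> a a \<ge> 0"
  using g_W_pos[OF assms, of a] by (cases "a = 0") (auto simp: g_W_def)

text \<open>The Wasserstein gradient represents the differential: positive definiteness makes the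
  metric tensor invertible, and it cancels the inverse in \<open>grad_W\<close>.\<close>

lemma g_W_grad_W:
  assumes "weighted_graph E \<omega>" "statistical_model \<Theta> p" "\<theta> \<in> \<Theta>"
  shows "g_W E \<omega> p \<theta> (grad_W E \<omega> p f \<theta>) v = euclidean_grad f \<theta> \<bullet> v"
proof -
  let ?G = "G_W E \<omega> p \<theta>"
  have "a = 0" if "?G *v a = 0" for a
    using that g_W_pos[OF assms, of a] by (auto simp: g_W_def)
  then have "invertible ?G"
    by (simp add: invertible_left_inverse matrix_left_invertible_ker)
  then have "?G ** matrix_inv ?G = mat 1 \<and> matrix_inv ?G ** ?G = mat 1"
    unfolding invertible_def matrix_inv_def by (rule someI_ex)
  then show ?thesis
    by (simp add: g_W_def grad_W_def inner_matrix_transpose[of _ ?G] transpose_G_W[OF assms]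
        matrix_vector_mul_assoc del: transpose_matrix_vector)
qed

lemma euclidean_grad_inner:
  assumes "f differentiable (at \<theta>)"
  shows "euclidean_grad f \<theta> \<bullet> v = frechet_derivative f (at \<theta>) v"
proof -
  have lin: "linear (frechet_derivative f (at \<theta>))"
    using assms by (rule linear_frechet_derivative)
  have "frechet_derivative f (at \<theta>) v = frechet_derivative f (at \<theta>) (\<Sum>j\<in>UNIV. v $ j *\<^sub>R axis j 1)"
    by (simp add: basis_expansion flip: scalar_mult_eq_scaleR)
  also have "\<dots> = (\<Sum>j\<in>UNIV. v $ j * frechet_derivative f (at \<theta>) (axis j 1))"
    by (simp add: linear_sum[OF lin] linear_scale[OF lin] o_def)
  finally show ?thesis
    by (simp add: euclidean_grad_def inner_vec_def mult.commute)
qed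

lemma D_KL_differentiable:
  assumes p: "p differentiable (at \<theta>)" and pos: "p \<theta> \<in> pos_simplex" "q \<in> pos_simplex"
  shows "(\<lambda>\<theta>. D_KL (p \<theta>) q) differentiable (at \<theta>)"
proof -
  obtain p' where p': "(p has_derivative p') (at \<theta>)"
    using p by (auto simp: differentiable_def)
  have comp: "((\<lambda>\<theta>. p \<theta> $ i) has_derivative (\<lambda>h. p' h $ i)) (at \<theta>)" for i
    using p' by (rule bounded_linear.has_derivative[OF bounded_linear_vec_nth])
  have "p \<theta> $ i / q $ i > 0" for i
    using pos by (auto simp: pos_simplex_def)
  then have "(\<lambda>\<theta>. p \<theta> $ i * ln (p \<theta> $ i / q $ i)) differentiable (at \<theta>)" for i
    unfolding differentiable_def
    by (intro exI) (rule has_derivative_mult[OF comp has_derivative_ln[OF _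
          bounded_linear.has_derivative[OF bounded_linear_divide comp]]])
  then show ?thesis
    unfolding D_KL_def by (intro differentiable_sum) auto
qed

section \<open>Geodesics and the three inequalities\<close>

text \<open>Since \<open>sqrt\<close> is negative on negative reals, the infimum itself must be
  shown nonnegative; the given curve makes the set of energies nonempty.\<close>

lemma d_W_nonneg:
  assumes graph: "weighted_graph E \<omega>" and model: "statistical_model \<Theta> p"
    and curve: "C1_curve \<Theta> \<theta>0 \<theta>1 \<gamma>"
  shows "d_W E \<omega> \<Theta> p \<theta>0 \<theta>1 \<ge> 0"
proof -
  have "energy E \<omega> p \<eta> \<ge> 0" if "C1_curve \<Theta> \<theta>0 \<theta>1 \<eta>" for \<eta>
  proof -
    have "g_W E \<omega> p (\<eta> t) (velocity \<eta> t) (velocity \<eta> t) \<ge> 0" if "t \<in> {0..1}" for t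
      using \<open>C1_curve \<Theta> \<theta>0 \<theta>1 \<eta>\<close> that
      by (intro g_W_nonneg[OF graph model]) (auto simp: C1_curve_def)
    then show ?thesis
      \<comment> \<open>A non-integrable integrand has integral \<open>0\<close> by convention,
        which is harmless here.\<close>
      unfolding energy_def by (cases "(\<lambda>t. g_W E \<omega> p (\<eta> t) (velocity \<eta> t) (velocity \<eta> t)) integrable_on {0..1}")
        (auto simp: not_integrable_integral intro: integral_nonneg)
  qed
  then show ?thesis
    unfolding d_W_def using curve by (auto intro!: cInf_greatest)
qed

text \<open>With constant speed \<open>c\<close> the energy over the unit interval is
  \<open>c^2\<close>, which minimality equates with the squared distance; both roots are
  nonnegative.\<close>

lemma geodesic_speed:
  assumes graph: "weighted_graph E \<omega>" and model: "statistical_model \<Theta> p"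
    and geo: "constant_speed_geodesic E \<omega> \<Theta> p \<theta>0 \<theta>1 \<gamma>" and t: "t \<in> {0..1}"
  shows "sqrt (g_W E \<omega> p (\<gamma> t) (velocity \<gamma> t) (velocity \<gamma> t)) = d_W E \<omega> \<Theta> p \<theta>0 \<theta>1"
proof -
  let ?g = "\<lambda>t. g_W E \<omega> p (\<gamma> t) (velocity \<gamma> t) (velocity \<gamma> t)"
  have curve: "C1_curve \<Theta> \<theta>0 \<theta>1 \<gamma>"
    using geo by (simp add: constant_speed_geodesic_def)
  have nonneg: "?g t \<ge> 0" if "t \<in> {0..1}" for t
    using curve that by (intro g_W_nonneg[OF graph model]) (auto simp: C1_curve_def)
  obtain c where c: "sqrt (?g t) = c" if "t \<in> {0..1}" for t
    using geo by (auto simp: constant_speed_geodesic_def)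
  have "?g t = c\<^sup>2" if "t \<in> {0..1}" for t
    using nonneg c that by (metis real_sqrt_pow2)
  then have "energy E \<omega> p \<gamma> = integral {0..1} (\<lambda>t::real. c\<^sup>2)"
    unfolding energy_def by (intro integral_cong)
  then have "c\<^sup>2 = (d_W E \<omega> \<Theta> p \<theta>0 \<theta>1)\<^sup>2"
    using geo by (simp add: constant_speed_geodesic_def)
  moreover have "c \<ge> 0"
    using c[OF t] nonneg[OF t] by (metis real_sqrt_ge_zero)
  ultimately have "c = d_W E \<omega> \<Theta> p \<theta>0 \<theta>1"
    using d_W_nonneg[OF graph model curve] by (simp add: power2_eq_iff_nonneg)
  then show ?thesis
    using c[OF t] by simp
qed

text \<open>By the chain rule the slope at the start is the Wasserstein inner product of the
  gradient with the initial velocity. Cauchy-Schwarz bounds it, and the initial speed equals the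
  distance.\<close>

lemma geodesic_derivative_bound:
  assumes graph: "weighted_graph E \<omega>" and model: "statistical_model \<Theta> p"
    and geo: "constant_speed_geodesic E \<omega> \<Theta> p \<theta>0 \<theta>1 \<gamma>"
    and diff: "f differentiable (at \<theta>0)"
  obtains D where "((\<lambda>t. f (\<gamma> t)) has_real_derivative D) (at 0 within {0..1})"
    "- D \<le> sqrt (g_W E \<omega> p \<theta>0 (grad_W E \<omega> p f \<theta>0) (grad_W E \<omega> p f \<theta>0)) *
      d_W E \<omega> \<Theta> p \<theta>0 \<theta>1"
proof
  let ?v = "velocity \<gamma> 0"
  let ?a = "grad_W E \<omega> p f \<theta>0"
  let ?D = "euclidean_grad f \<theta>0 \<bullet> ?v"
  have curve: "C1_curve \<Theta> \<theta>0 \<theta>1 \<gamma>"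
    using geo by (simp add: constant_speed_geodesic_def)
  then have start: "\<gamma> 0 = \<theta>0" "\<theta>0 \<in> \<Theta>"
    by (force simp: C1_curve_def)+
  have "(\<gamma> has_vector_derivative ?v) (at 0 within {0..1})"
    using curve unfolding C1_curve_def velocity_def by (simp flip: vector_derivative_works)
  moreover have "(f has_derivative frechet_derivative f (at \<theta>0)) (at (\<gamma> 0))"
    using diff start by (simp add: frechet_derivative_works)
  ultimately have "((\<lambda>t. f (\<gamma> t)) has_derivative (\<lambda>h. frechet_derivative f (at \<theta>0) (h *\<^sub>R ?v)))
      (at 0 within {0..1})"
    unfolding has_vector_derivative_def by (rule has_derivative_compose)
  moreover have "frechet_derivative f (at \<theta>0) (h *\<^sub>R ?v) = ?D * h" for h
    by (simp add: mult.commute flip: euclidean_grad_inner[OF diff])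
  ultimately show "((\<lambda>t. f (\<gamma> t)) has_real_derivative ?D) (at 0 within {0..1})"
    by (simp add: has_field_derivative_def)
  have "- ?D \<le> \<bar>g_W E \<omega> p \<theta>0 ?a ?v\<bar>"
    by (simp add: g_W_grad_W[OF graph model start(2)])
  also have "\<dots> \<le> sqrt (g_W E \<omega> p \<theta>0 ?a ?a) * sqrt (g_W E \<omega> p \<theta>0 ?v ?v)"
    using g_W_pos[OF graph model start(2)] unfolding g_W_def
    by (intro pos_def_cauchy_schwarz transpose_G_W[OF graph model start(2)])
  also have "sqrt (g_W E \<omega> p \<theta>0 ?v ?v) = d_W E \<omega> \<Theta> p \<theta>0 \<theta>1"
    using geodesic_speed[OF graph model geo, of 0] start by simp
  finally show "- ?D \<le> sqrt (g_W E \<omega> p \<theta>0 ?a ?a) * d_W E \<omega> \<Theta> p \<theta>0 \<theta>1" .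
qed

text \<open>The convexity estimate bounds the difference quotient at \<open>0\<close> by
  \<open>\<phi> 1 - \<phi> 0 - k * (1 - t)\<close>; then \<open>t\<close> tends to \<open>0\<close>
  from the right.\<close>

lemma semiconvex_derivative_bound:
  fixes \<phi> :: "real \<Rightarrow> real"
  assumes deriv: "(\<phi> has_real_derivative D) (at 0 within {0..1})"
    and conv: "\<And>t. t \<in> {0..1} \<Longrightarrow> \<phi> t \<le> (1 - t) * \<phi> 0 + t * \<phi> 1 - k * t * (1 - t)"
  shows "D \<le> \<phi> 1 - \<phi> 0 - k"
proof (rule tendsto_le)
  show "((\<lambda>t. (\<phi> t - \<phi> 0) / (t - 0)) \<longlongrightarrow> D) (at_right 0)"
    using deriv unfolding has_field_derivative_iff
    by (simp add: at_within_Icc_at_right)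
  show "((\<lambda>t. \<phi> 1 - \<phi> 0 - k * (1 - t)) \<longlongrightarrow> \<phi> 1 - \<phi> 0 - k) (at_right 0)"
    by (auto intro!: tendsto_eq_intros)
  have "(\<phi> t - \<phi> 0) / (t - 0) \<le> \<phi> 1 - \<phi> 0 - k * (1 - t)" if "t \<in> {0<..<1}" for t
    using conv[of t] that by (simp add: field_simps)
  then show "\<forall>\<^sub>F t in at_right 0. (\<phi> t - \<phi> 0) / (t - 0) \<le> \<phi> 1 - \<phi> 0 - k * (1 - t)"
    by (intro eventually_at_rightI[of 0 1]) auto
qed simp

text \<open>Minimality at \<open>1\<close> replaces \<open>\<phi> t\<close> by
  \<open>\<phi> 1\<close> in the convexity estimate; cancelling \<open>1 - t\<close> leaves
  \<open>k * t \<le> \<phi> 0 - \<phi> 1\<close>, and \<open>t\<close> tends to \<open>1\<close>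
  from the left.\<close>

lemma semiconvex_growth:
  fixes \<phi> :: "real \<Rightarrow> real"
  assumes min: "\<And>t. t \<in> {0..1} \<Longrightarrow> \<phi> 1 \<le> \<phi> t"
    and conv: "\<And>t. t \<in> {0..1} \<Longrightarrow> \<phi> t \<le> (1 - t) * \<phi> 0 + t * \<phi> 1 - k * t * (1 - t)"
  shows "k \<le> \<phi> 0 - \<phi> 1"
proof (rule tendsto_le)
  show "((\<lambda>t. k * t) \<longlongrightarrow> k) (at_left 1)"
    by (auto intro!: tendsto_eq_intros)
  show "((\<lambda>t. \<phi> 0 - \<phi> 1) \<longlongrightarrow> \<phi> 0 - \<phi> 1) (at_left (1::real))"
    by simp
  have "k * t \<le> \<phi> 0 - \<phi> 1" if "t \<in> {0<..<1}" for t
  proof -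
    have "(1 - t) * (k * t) \<le> (1 - t) * (\<phi> 0 - \<phi> 1)"
      using min[of t] conv[of t] that by (simp add: algebra_simps)
    then show ?thesis
      using that by (simp add: mult_le_cancel_left)
  qed
  then show "\<forall>\<^sub>F t in at_left 1. k * t \<le> \<phi> 0 - \<phi> 1"
    by (intro eventually_at_leftI[of 0 1]) auto
qed simp

text \<open>The curvature bound speaks only about points joined by a minimizing geodesic, so the
  existence of one from each parameter to the minimizer is the explicit assumption
  \<open>geodesics\<close>.\<close>

theorem proposition10:
  fixes E :: "('n::finite \<times> 'n) set" and \<omega> :: "'n \<Rightarrow> 'n \<Rightarrow> real"
    and \<Theta> :: "(real^'d::finite) set" and p :: "real^'d \<Rightarrow> real^'n"
    and q :: "real^'n" and \<theta>s :: "real^'d" and \<kappa> :: real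
  assumes graph: "weighted_graph E \<omega>"
    and model: "statistical_model \<Theta> p"
    and reference: "q \<in> pos_simplex"
    and minimizer: "is_arg_min (\<lambda>\<theta>. D_KL (p \<theta>) q) (\<lambda>\<theta>. \<theta> \<in> \<Theta>) \<theta>s"
    and geodesics: "\<And>\<theta>. \<theta> \<in> \<Theta> \<Longrightarrow> \<exists>\<gamma>. constant_speed_geodesic E \<omega> \<Theta> p \<theta> \<theta>s \<gamma>"
  shows
    "(Ric_ge E \<omega> \<Theta> p q \<kappa> \<and> \<kappa> > 0 \<longrightarrow>
        (\<forall>\<theta>\<in>\<Theta>. D_KL (p \<theta>) q - D_KL (p \<theta>s) q
           \<le> 1 / (2 * \<kappa>) * rel_Fisher_information E \<omega> p q \<theta>)) \<and>
     (Ric_ge E \<omega> \<Theta> p q \<kappa> \<and> \<kappa> > 0 \<longrightarrow>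
        (\<forall>\<theta>\<in>\<Theta>. \<kappa> / 2 * (d_W E \<omega> \<Theta> p \<theta> \<theta>s)\<^sup>2
           \<le> D_KL (p \<theta>) q - D_KL (p \<theta>s) q)) \<and>
     (Ric_ge E \<omega> \<Theta> p q \<kappa> \<longrightarrow>
        (\<forall>\<theta>\<in>\<Theta>. D_KL (p \<theta>) q - D_KL (p \<theta>s) q
           \<le> sqrt (rel_Fisher_information E \<omega> p q \<theta>) * d_W E \<omega> \<Theta> p \<theta> \<theta>s
             - \<kappa> / 2 * (d_W E \<omega> \<Theta> p \<theta> \<theta>s)\<^sup>2))"
proof -
  let ?F = "\<lambda>\<theta>. D_KL (p \<theta>) q"
  let ?I = "rel_Fisher_information E \<omega> p q"
  let ?d = "\<lambda>\<theta>. d_W E \<omega> \<Theta> p \<theta> \<theta>s"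
  have min: "?F \<theta>s \<le> ?F \<theta>" if "\<theta> \<in> \<Theta>" for \<theta>
    using minimizer that by (auto simp: is_arg_min_def not_less)
  \<comment> \<open>This is the curvature bound in the shape of the one-variable lemmas, with
    \<open>k\<close> equal to \<open>\<kappa> / 2\<close> times the squared distance.\<close>
  have conv: "?F (\<gamma> t) \<le> (1 - t) * ?F (\<gamma> 0) + t * ?F (\<gamma> 1) - \<kappa> / 2 * (?d \<theta>)\<^sup>2 * t * (1 - t)"
    if "Ric_ge E \<omega> \<Theta> p q \<kappa>" "constant_speed_geodesic E \<omega> \<Theta> p \<theta> \<theta>s \<gamma>" "t \<in> {0..1}" for \<theta> \<gamma> t
  proof -
    have "?F (\<gamma> t) \<le> (1 - t) * ?F \<theta> + t * ?F \<theta>s - \<kappa> / 2 * t * (1 - t) * (?d \<theta>)\<^sup>2"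
      using that unfolding Ric_ge_def by blast
    moreover have "\<gamma> 0 = \<theta>" "\<gamma> 1 = \<theta>s"
      using that(2) by (simp_all add: constant_speed_geodesic_def C1_curve_def)
    ultimately show ?thesis
      by (simp add: mult_ac)
  qed
  have talagrand: "\<kappa> / 2 * (?d \<theta>)\<^sup>2 \<le> ?F \<theta> - ?F \<theta>s"
    if ric: "Ric_ge E \<omega> \<Theta> p q \<kappa>" and \<theta>: "\<theta> \<in> \<Theta>" for \<theta>
  proof -
    obtain \<gamma> where geo: "constant_speed_geodesic E \<omega> \<Theta> p \<theta> \<theta>s \<gamma>"
      using geodesics[OF \<theta>] by blast
    then have \<gamma>: "\<gamma> ` {0..1} \<subseteq> \<Theta>" "\<gamma> 0 = \<theta>" "\<gamma> 1 = \<theta>s"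
      by (simp_all add: constant_speed_geodesic_def C1_curve_def)
    have "\<kappa> / 2 * (?d \<theta>)\<^sup>2 \<le> ?F (\<gamma> 0) - ?F (\<gamma> 1)"
    proof (rule semiconvex_growth[of "\<lambda>t. ?F (\<gamma> t)"])
      show "?F (\<gamma> 1) \<le> ?F (\<gamma> t)" if "t \<in> {0..1}" for t
        unfolding \<gamma>(3) using \<gamma>(1) that by (intro min) blast
    qed (rule conv[OF ric geo])
    then show ?thesis
      by (simp add: \<gamma>)
  qed
  have hwi: "?F \<theta> - ?F \<theta>s \<le> sqrt (?I \<theta>) * ?d \<theta> - \<kappa> / 2 * (?d \<theta>)\<^sup>2"
    if ric: "Ric_ge E \<omega> \<Theta> p q \<kappa>" and \<theta>: "\<theta> \<in> \<Theta>" for \<theta>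
  proof -
    obtain \<gamma> where geo: "constant_speed_geodesic E \<omega> \<Theta> p \<theta> \<theta>s \<gamma>"
      using geodesics[OF \<theta>] by blast
    then have \<gamma>: "\<gamma> 0 = \<theta>" "\<gamma> 1 = \<theta>s"
      by (simp_all add: constant_speed_geodesic_def C1_curve_def)
    have "?F differentiable (at \<theta>)"
      using model \<theta> reference by (intro D_KL_differentiable) (auto simp: statistical_model_def)
    from geodesic_derivative_bound[OF graph model geo this] obtain D
      where D: "((\<lambda>t. ?F (\<gamma> t)) has_real_derivative D) (at 0 within {0..1})"
        "- D \<le> sqrt (?I \<theta>) * ?d \<theta>"
      unfolding rel_Fisher_information_def .
    have "D \<le> ?F (\<gamma> 1) - ?F (\<gamma> 0) - \<kappa> / 2 * (?d \<theta>)\<^sup>2"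
      by (rule semiconvex_derivative_bound[OF D(1) conv[OF ric geo]])
    with D(2) show ?thesis
      by (simp add: \<gamma>)
  qed
  have "?F \<theta> - ?F \<theta>s \<le> 1 / (2 * \<kappa>) * ?I \<theta>"
    if ric: "Ric_ge E \<omega> \<Theta> p q \<kappa>" and \<kappa>: "\<kappa> > 0" and \<theta>: "\<theta> \<in> \<Theta>" for \<theta>
  proof -
    \<comment> \<open>The Fisher information is a value of the nonnegative metric form, so squaring
      undoes the root.\<close>
    have I: "(sqrt (?I \<theta>))\<^sup>2 = ?I \<theta>"
      using g_W_nonneg[OF graph model \<theta>] by (simp add: rel_Fisher_information_def)
    \<comment> \<open>Expanding this square shows that the right-hand side of HWI is at most the
      Fisher information over \<open>2 * \<kappa>\<close>.\<close>
    have "0 \<le> (sqrt (?I \<theta>) - \<kappa> * ?d \<theta>)\<^sup>2 / (2 * \<kappa>)"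
      using \<kappa> by simp
    also have "\<dots> = 1 / (2 * \<kappa>) * (sqrt (?I \<theta>))\<^sup>2 - (sqrt (?I \<theta>) * ?d \<theta> - \<kappa> / 2 * (?d \<theta>)\<^sup>2)"
      using \<kappa> by (simp add: power2_eq_square field_simps)
    finally show ?thesis
      using hwi[OF ric \<theta>] unfolding I by linarith
  qed
  with talagrand hwi show ?thesis
    by blast
qed

end
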